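(* Let $k_0\in D$ and let a value $\tilde w_{k_0}$ be given. Let $(\bar w^*,\bar b^*,\bar\xi^*,\bar z^* )$ be an optimal solution of $(\overline{\mathrm{Re}\text{-}\mathrm{RL}\text{-}\ell_2})_{k_0}$ with $\bar w^*_{k_0}=0$, let $Z_{k_0}$ be its objective value, and let $\bar\alpha$ be a vector of optimal values for the dual variables associated with the constraints (A). Then the following bounds of the $w$-variables are obtained for the problem $(\mathrm{Re}\text{-}\mathrm{RL}\text{-}\ell_2)$: $$w_{k_0}\ge\mathrm{LB}_{w_{k_0}}:=\sum_{i=1}^n\bar\alpha_iy_ix_{ik_0}-\sqrt{\left(\tilde w_{k_0}-\sum_{i=1}^n\bar\alpha_iy_ix_{ik_0}\right)^2-2\left(Z_{k_0}-\mathrm{UB}_{\mathrm{RL}\text{-}\ell_2}\right)},$$ $$w_{k_0}\le\mathrm{UB}_{w_{k_0}}:=\sum_{i=1}^n\bar\alpha_iy_ix_{ik_0}+\sqrt{\left(\tilde w_{k_0}-\sum_{i=1}^n\bar\alpha_iy_ix_{ik_0}\right)^2-2\left(Z_{k_0}-\mathrm{UB}_{\mathrm{RL}\text{-}\ell_2}\right)},$$ where $\mathrm{UB}_{\mathrm{RL}\text{-}\ell_2}$ is an upper bound of $(\mathrm{RL}\text{-}\ell_2\text{-}\mathrm{M})$.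
   Context: Data: $N=\{1,\dots,n\}$, $D=\{1,\dots,d\}$, $x_i\in\mathbb R^d$, $y_i\in\{-1,1\}$ for $i\in N$, a non-negative constant $C$, and big enough constants $M_i$ ($i\in N$). $(\mathrm{RL}\text{-}\ell_2\text{-}\mathrm{M})$: minimize $\frac12\sum_{k=1}^dw_k^2+C\left(\sum_{i=1}^n\xi_i+2\sum_{i=1}^nz_i\right)$ over $w\in\mathbb R^d$, $b\in\mathbb R$, $\xi,z\in\mathbb R^n$ subject to $0\le\xi_i\le2$, $\xi_i\le2(1-z_i)$, $z_i\in\{0,1\}$ and $y_i\left(\sum_{k=1}^dw_kx_{ik}+b\right)\ge1-\xi_i-M_iz_i$ ($i\in N$). $(\mathrm{Re}\text{-}\mathrm{RL}\text{-}\ell_2)$ is the same problem with $z_i\in\{0,1\}$ relaxed to $0\le z_i\le1$. $(\overline{\mathrm{Re}\text{-}\mathrm{RL}\text{-}\ell_2})_{k_0}$ is obtained from $(\mathrm{Re}\text{-}\mathrm{RL}\text{-}\ell_2)$ by the change of variables $\bar w_{k_0}=w_{k_0}-\tilde w_{k_0}$, $\bar w_k=w_k$ for $k\neq k_0$: minimize $\frac12\sum_{k=1}^d\bar w_k^2+C\left(\sum_{i=1}^n\bar\xi_i+2\sum_{i=1}^n\bar z_i\right)+\frac12\tilde w_{k_0}^2+\tilde w_{k_0}\bar w_{k_0}$ subject to $\bar\xi_i\le2(1-\bar z_i)$, $0\le\bar\xi_i\le2$, $0\le\bar z_i\le1$, and (A) $y_i\left(\sum_{k=1}^d\bar w_kx_{ik}+\bar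 b\right)\ge1-\bar\xi_i-y_i\tilde w_{k_0}x_{ik_0}-M_i\bar z_i$ ($i\in N$). The dual variables of the constraints (A) are non-negative. *)

theory Defs
  imports "HOL-Analysis.Analysis"
begin

text \<open>
  The index sets are the finite types \<open>'d\<close> (features) and \<open>'n\<close> (data points).
  A point of any of the problems is a tuple \<open>(w, b, \<xi>, z)\<close>.  The data are the
  points \<open>x $ i\<close>, the labels \<open>y $ i\<close>, the constants \<open>M $ i\<close> and the penalty \<open>C\<close>.
\<close>

type_synonym ('d, 'n) svm_point = "(real^'d) \<times> real \<times> (real^'n) \<times> (real^'n)"

text \<open>The common objective of (RL-l2-M) and of its continuous relaxation (Re-RL-l2).\<close>

fun rl_objective :: "real \<Rightarrow> ('d::finite, 'n::finite) svm_point \<Rightarrow> real" where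
  "rl_objective C (w, b, \<xi>, z) =
     1/2 * (\<Sum>k\<in>UNIV. (w $ k)\<^sup>2) + C * ((\<Sum>i\<in>UNIV. \<xi> $ i) + 2 * (\<Sum>i\<in>UNIV. z $ i))"

definition rl_feasible ::
  "real^'d^'n \<Rightarrow> real^'n \<Rightarrow> real^'n \<Rightarrow> ('d::finite, 'n::finite) svm_point set" where
  "rl_feasible x y M = {(w, b, \<xi>, z). \<forall>i.
     0 \<le> \<xi> $ i \<and> \<xi> $ i \<le> 2 \<and> \<xi> $ i \<le> 2 * (1 - z $ i) \<and> z $ i \<in> {0, 1} \<and>
     y $ i * ((\<Sum>k\<in>UNIV. w $ k * x $ i $ k) + b) \<ge> 1 - \<xi> $ i - M $ i * z $ i}"

definition re_rl_feasible ::
  "real^'d^'n \<Rightarrow> real^'n \<Rightarrow> real^'n \<Rightarrow> ('d::finite, 'n::finite) svm_point set" where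
  "re_rl_feasible x y M = {(w, b, \<xi>, z). \<forall>i.
     0 \<le> \<xi> $ i \<and> \<xi> $ i \<le> 2 \<and> \<xi> $ i \<le> 2 * (1 - z $ i) \<and> 0 \<le> z $ i \<and> z $ i \<le> 1 \<and>
     y $ i * ((\<Sum>k\<in>UNIV. w $ k * x $ i $ k) + b) \<ge> 1 - \<xi> $ i - M $ i * z $ i}"

text \<open>
  \<open>u\<close> is an upper bound of the problem (RL-l2-M), i.e. of its optimal value.  (The objective
  value of any feasible point is such a \<open>u\<close>.)
\<close>

definition rl_upper_bound ::
  "real \<Rightarrow> real^'d^'n \<Rightarrow> real^'n \<Rightarrow> real^'n \<Rightarrow> real \<Rightarrow> bool" where
  "rl_upper_bound C x y M u \<longleftrightarrow>
     (INF p \<in> (rl_feasible x y M :: ('d::finite, 'n::finite) svm_point set).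
        ereal (rl_objective C p)) \<le> ereal u"

text \<open>
  The problem obtained from (Re-RL-l2) by the substitution of \<open>w $ k0 - wt\<close> for the
  \<open>k0\<close>-th component of \<open>w\<close>.
  The extra argument \<open>W\<close> is the range allowed for the new variable \<open>w $ k0\<close>:  \<open>W = UNIV\<close> is the
  problem as it stands, \<open>W = {0}\<close> is the problem in which \<open>w $ k0\<close> is fixed to \<open>0\<close>,
  that is, the original variable is fixed to \<open>wt\<close>.
\<close>

fun shifted_objective ::
  "real \<Rightarrow> 'd \<Rightarrow> real \<Rightarrow> ('d::finite, 'n::finite) svm_point \<Rightarrow> real" where
  "shifted_objective C k0 wt (w, b, \<xi>, z) =
     1/2 * (\<Sum>k\<in>UNIV. (w $ k)\<^sup>2) + C * ((\<Sum>i\<in>UNIV. \<xi> $ i) + 2 * (\<Sum>i\<in>UNIV. z $ i))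
       + 1/2 * wt\<^sup>2 + wt * w $ k0"

text \<open>The constraints (A) read \<open>shifted_gap x y M k0 wt p i \<le> 0\<close>.\<close>

fun shifted_gap ::
  "real^'d^'n \<Rightarrow> real^'n \<Rightarrow> real^'n \<Rightarrow> 'd \<Rightarrow> real \<Rightarrow> ('d::finite, 'n::finite) svm_point \<Rightarrow> 'n \<Rightarrow> real"
  where
  "shifted_gap x y M k0 wt (w, b, \<xi>, z) i =
     (1 - \<xi> $ i - y $ i * wt * x $ i $ k0 - M $ i * z $ i)
       - y $ i * ((\<Sum>k\<in>UNIV. w $ k * x $ i $ k) + b)"

definition shifted_domain :: "'d \<Rightarrow> real set \<Rightarrow> ('d::finite, 'n::finite) svm_point set" where
  "shifted_domain k0 W = {(w, b, \<xi>, z). w $ k0 \<in> W \<and> (\<forall>i.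
     \<xi> $ i \<le> 2 * (1 - z $ i) \<and> 0 \<le> \<xi> $ i \<and> \<xi> $ i \<le> 2 \<and> 0 \<le> z $ i \<and> z $ i \<le> 1)}"

definition shifted_feasible ::
  "real^'d^'n \<Rightarrow> real^'n \<Rightarrow> real^'n \<Rightarrow> 'd \<Rightarrow> real \<Rightarrow> real set \<Rightarrow> ('d::finite, 'n::finite) svm_point set"
  where
  "shifted_feasible x y M k0 wt W =
     {p \<in> shifted_domain k0 W. \<forall>i. shifted_gap x y M k0 wt p i \<le> 0}"

text \<open>
  The Lagrangian dual with respect to the constraints (A): the dual function takes the value
  \<open>- \<infinity>\<close> where the Lagrangian is unbounded below on the domain, and the dual variables are
  non-negative.
\<close>

definition shifted_lagrangian ::
  "real \<Rightarrow> real^'d^'n \<Rightarrow> real^'n \<Rightarrow> real^'n \<Rightarrow> 'd \<Rightarrow> real \<Rightarrow> real^'n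
     \<Rightarrow> ('d::finite, 'n::finite) svm_point \<Rightarrow> real" where
  "shifted_lagrangian C x y M k0 wt \<alpha> p =
     shifted_objective C k0 wt p + (\<Sum>i\<in>UNIV. \<alpha> $ i * shifted_gap x y M k0 wt p i)"

definition shifted_dual_function ::
  "real \<Rightarrow> real^'d^'n \<Rightarrow> real^'n \<Rightarrow> real^'n \<Rightarrow> 'd::finite \<Rightarrow> real \<Rightarrow> real set \<Rightarrow> real^'n::finite \<Rightarrow> ereal"
  where
  "shifted_dual_function C x y M k0 wt W \<alpha> =
     (INF p \<in> shifted_domain k0 W. ereal (shifted_lagrangian C x y M k0 wt \<alpha> p))"

definition shifted_dual_optimal ::
  "real \<Rightarrow> real^'d^'n \<Rightarrow> real^'n \<Rightarrow> real^'n \<Rightarrow> 'd::finite \<Rightarrow> real \<Rightarrow> real set \<Rightarrow> real^'n::finite \<Rightarrow> bool"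
  where
  "shifted_dual_optimal C x y M k0 wt W \<alpha> \<longleftrightarrow>
     is_arg_max (shifted_dual_function C x y M k0 wt W) (\<lambda>\<beta>. \<forall>i. 0 \<le> \<beta> $ i) \<alpha>"

end

theory Submission
  imports Defs
begin

text \<open>
  A minimiser of a convex quadratic over a polyhedron also minimises the linearisation at that point,
  so Farkas' lemma yields multipliers \<open>\<beta>\<close> of (A) whose dual value is at least \<open>Z\<close>, without any
  constraint qualification; hence the Lagrangian at \<open>\<alpha>\<close> is at least \<open>Z\<close> on the whole domain.
  For a point \<open>p\<close> of (Re-RL-l2) with objective value \<open>v\<close>, evaluate this at \<open>p\<close> with \<open>w $ k0\<close>
  replaced by \<open>0\<close>.  The Lagrangian there is at most
  \<open>v - ((w $ k0)\<^sup>2 - wt\<^sup>2) / 2 + (w $ k0 - wt) * S\<close>, and completing the square gives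
  \<open>(w $ k0 - S)\<^sup>2 \<le> (wt - S)\<^sup>2 - 2 * (Z - v)\<close>.
\<close>

section \<open>Farkas' lemma and multipliers for linear programs\<close>

text \<open>A finitely generated cone is closed, so a point outside it is strictly separated from it
  by some \<open>u\<close>. As the cone contains 0 and all nonnegative multiples of generators,
  \<open>u\<close> is nonnegative on \<open>A\<close>, and \<open>- u\<close> violates
  \<open>dual\<close>.\<close>

lemma farkas:
  fixes A :: "'a::euclidean_space set"
  assumes "finite A" and dual: "\<And>v. (\<And>a. a \<in> A \<Longrightarrow> a \<bullet> v \<le> 0) \<Longrightarrow> c \<bullet> v \<le> 0"
  shows "c \<in> convex_cone hull A"
proof (rule ccontr)
  assume "c \<notin> convex_cone hull A"
  then obtain u \<beta> where u: "u \<bullet> c < \<beta>" "\<And>x. x \<in> convex_cone hull A \<Longrightarrow> \<beta> < u \<bullet> x"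
    using separating_hyperplane_closed_point[OF convex_convex_cone_hull
        closed_convex_cone_hull[OF \<open>finite A\<close>]] by meson
  have \<beta>: "\<beta> < 0"
    using u(2)[OF convex_cone_hull_contains_0] by simp
  have "0 \<le> u \<bullet> a" if "a \<in> A" for a
  proof (rule ccontr)
    assume "\<not> 0 \<le> u \<bullet> a"
    \<comment> \<open>The multiple is chosen so that \<open>u\<close> takes exactly the value
      \<beta> on it, which the strict bound forbids.\<close>
    with \<beta> have "(\<beta> / (u \<bullet> a)) *\<^sub>R a \<in> convex_cone hull A"
      by (intro convex_cone_hull_mul hull_inc that) (simp add: divide_nonpos_nonpos)
    from u(2)[OF this] show False
      using \<open>\<not> 0 \<le> u \<bullet> a\<close> by simp
  qed
  then have "c \<bullet> - u \<le> 0"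
    by (intro dual) (simp add: inner_commute)
  with u(1) \<beta> show False
    by (simp add: inner_commute)
qed

text \<open>A slack constraint survives short moves by continuity; an active one survives because
  \<open>v\<close> does not increase it.\<close>

lemma eventually_halfspace_along_ray:
  fixes a p v :: "'a::real_inner"
  assumes "a \<bullet> p \<le> \<beta>" and active: "a \<bullet> p = \<beta> \<Longrightarrow> a \<bullet> v \<le> 0"
  shows "\<forall>\<^sub>F t in at_right 0. a \<bullet> (p + t *\<^sub>R v) \<le> \<beta>"
proof (cases "a \<bullet> p = \<beta>")
  case True
  show ?thesis
    using eventually_at_right_less[of "0::real"]
    by eventually_elim (use True active in \<open>simp add: inner_add_right mult_nonneg_nonpos\<close>)
next
  case False
  have "((\<lambda>t. a \<bullet> (p + t *\<^sub>R v)) \<longlongrightarrow> a \<bullet> (p + 0 *\<^sub>R v)) (at_right 0)"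
    by (intro tendsto_intros)
  then have "\<forall>\<^sub>F t in at_right 0. a \<bullet> (p + t *\<^sub>R v) < \<beta>"
    by (rule order_tendstoD) (use False assms(1) in simp)
  then show ?thesis
    by eventually_elim simp
qed

text \<open>A direction that increases no active constraint can be followed for a short while, so
  \<open>c\<close> does not decrease along it, and Farkas' lemma puts \<open>- c\<close> in the cone
  of the active normals. Only the constraints \<open>a i\<close> keep explicit multipliers; those
  describing \<open>D\<close> are absorbed by restricting \<open>q\<close> to
  \<open>D\<close>.\<close>

lemma linear_program_multipliers:
  fixes a :: "'i \<Rightarrow> 'a::euclidean_space"
  assumes "finite I" and "polyhedron D" and "p \<in> D" and ap: "\<And>i. i \<in> I \<Longrightarrow> a i \<bullet> p \<le> b i"
    and opt: "\<And>q. q \<in> D \<Longrightarrow> (\<And>i. i \<in> I \<Longrightarrow> a i \<bullet> q \<le> b i) \<Longrightarrow> c \<bullet> p \<le> c \<bullet> q"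
  obtains \<beta> where "\<And>i. 0 \<le> \<beta> i"
    and "\<And>q. q \<in> D \<Longrightarrow> c \<bullet> p \<le> c \<bullet> q + (\<Sum>i\<in>I. \<beta> i * (a i \<bullet> q - b i))"
proof -
  obtain F where "finite F" and DF: "D = \<Inter>F"
    and F: "\<forall>h\<in>F. \<exists>n r. n \<noteq> 0 \<and> h = {x. n \<bullet> x \<le> r}"
    using \<open>polyhedron D\<close> unfolding polyhedron_def by blast
  then obtain n r where nr: "\<And>h. h \<in> F \<Longrightarrow> h = {x. n h \<bullet> x \<le> r h}"
    by metis
  have D_iff: "q \<in> D \<longleftrightarrow> (\<forall>h\<in>F. n h \<bullet> q \<le> r h)" for q
    unfolding DF using nr by blast
  \<comment> \<open>Here \<open>m\<close> ranges over the normal cone of \<open>D\<close> at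
    \<open>p\<close>, and the products with \<beta> vanish by complementary slackness. As a convex
    cone containing the active normals, \<open>T\<close> contains their hull.\<close>
  define T where "T = {(\<Sum>i\<in>I. \<beta> i *\<^sub>R a i) + m | \<beta> m. (\<forall>i. 0 \<le> \<beta> i) \<and>
    (\<forall>i\<in>I. \<beta> i * (a i \<bullet> p - b i) = 0) \<and> (\<forall>q\<in>D. m \<bullet> (q - p) \<le> 0)}"
  have T_I: "u \<in> T" if "u = (\<Sum>i\<in>I. \<beta> i *\<^sub>R a i) + m" "\<And>i. 0 \<le> \<beta> i"
    "\<And>i. i \<in> I \<Longrightarrow> \<beta> i * (a i \<bullet> p - b i) = 0" "\<And>q. q \<in> D \<Longrightarrow> m \<bullet> (q - p) \<le> 0" for u \<beta> m
    unfolding T_def using that by blast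
  define A where "A = a ` {i \<in> I. a i \<bullet> p = b i}"
  define N where "N = n ` {h \<in> F. n h \<bullet> p = r h}"
  have "- c \<in> convex_cone hull (A \<union> N)"
  proof (rule farkas)
    show "finite (A \<union> N)"
      by (simp add: A_def N_def \<open>finite I\<close> \<open>finite F\<close>)
    fix v
    assume v: "\<And>u. u \<in> A \<union> N \<Longrightarrow> u \<bullet> v \<le> 0"
    have "\<forall>\<^sub>F t in at_right 0. \<forall>i\<in>I. a i \<bullet> (p + t *\<^sub>R v) \<le> b i"
      using \<open>finite I\<close> ap v
      by (intro eventually_ball_finite ballI eventually_halfspace_along_ray) (auto simp: A_def)
    moreover have "\<forall>\<^sub>F t in at_right 0. \<forall>h\<in>F. n h \<bullet> (p + t *\<^sub>R v) \<le> r h"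
      using \<open>finite F\<close> \<open>p \<in> D\<close> v unfolding D_iff
      by (intro eventually_ball_finite ballI eventually_halfspace_along_ray) (auto simp: N_def)
    ultimately have "\<forall>\<^sub>F t in at_right 0. 0 < t \<and> c \<bullet> p \<le> c \<bullet> (p + t *\<^sub>R v)"
      using eventually_at_right_less[of "0::real"] by eventually_elim (simp add: D_iff opt)
    then obtain t :: real where "0 < t" "c \<bullet> p \<le> c \<bullet> (p + t *\<^sub>R v)"
      using eventually_happens'[OF trivial_limit_at_right_real] by blast
    then show "- c \<bullet> v \<le> 0"
      by (simp add: inner_add_right zero_le_mult_iff)
  qed
  also have "convex_cone hull (A \<union> N) \<subseteq> T"
  proof (rule hull_minimal)
    show "A \<union> N \<subseteq> T"
    proof
      fix u
      assume "u \<in> A \<union> N"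
      \<comment> \<open>An active \<open>a j\<close> takes the indicator of \<open>j\<close> as its
        multipliers; an active normal of \<open>D\<close> goes into \<open>m\<close>.\<close>
      then consider j where "j \<in> I" "a j \<bullet> p = b j" "u = a j"
        | h where "h \<in> F" "n h \<bullet> p = r h" "u = n h"
        by (auto simp: A_def N_def)
      then show "u \<in> T"
      proof cases
        case 1
        show ?thesis
        proof (rule T_I)
          show "u = (\<Sum>i\<in>I. of_bool (i = j) *\<^sub>R a i) + 0"
            using 1 \<open>finite I\<close> by (simp add: of_bool_def if_distrib[of "\<lambda>x. x *\<^sub>R _"] cong: if_cong)
        qed (use 1 in auto)
      next
        case 2
        show ?thesis
        proof (rule T_I)
          show "u = (\<Sum>i\<in>I. 0 *\<^sub>R a i) + n h"
            using 2 by simp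
        qed (use 2 in \<open>auto simp: D_iff inner_diff_right\<close>)
      qed
    qed
    show "convex_cone T"
      unfolding convex_cone_iff
    proof (intro conjI ballI allI impI)
      show "0 \<in> T"
        by (rule T_I[of _ "\<lambda>_. 0" 0]) simp_all
    next
      fix u u'
      assume "u \<in> T" "u' \<in> T"
      then obtain \<beta> m \<beta>' m' where u: "u = (\<Sum>i\<in>I. \<beta> i *\<^sub>R a i) + m" "u' = (\<Sum>i\<in>I. \<beta>' i *\<^sub>R a i) + m'"
        and *: "\<forall>i. 0 \<le> \<beta> i" "\<forall>i\<in>I. \<beta> i * (a i \<bullet> p - b i) = 0" "\<forall>q\<in>D. m \<bullet> (q - p) \<le> 0"
          "\<forall>i. 0 \<le> \<beta>' i" "\<forall>i\<in>I. \<beta>' i * (a i \<bullet> p - b i) = 0" "\<forall>q\<in>D. m' \<bullet> (q - p) \<le> 0"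
        unfolding T_def by blast
      show "u + u' \<in> T"
      proof (rule T_I)
        show "u + u' = (\<Sum>i\<in>I. (\<beta> i + \<beta>' i) *\<^sub>R a i) + (m + m')"
          by (simp add: u scaleR_add_left sum.distrib)
      qed (use * in \<open>auto simp: distrib_right inner_add_left add_nonpos_nonpos\<close>)
    next
      fix u and s :: real
      assume "u \<in> T" "0 \<le> s"
      then obtain \<beta> m where u: "u = (\<Sum>i\<in>I. \<beta> i *\<^sub>R a i) + m"
        and *: "\<forall>i. 0 \<le> \<beta> i" "\<forall>i\<in>I. \<beta> i * (a i \<bullet> p - b i) = 0" "\<forall>q\<in>D. m \<bullet> (q - p) \<le> 0"
        unfolding T_def by blast
      show "s *\<^sub>R u \<in> T"
      proof (rule T_I)
        show "s *\<^sub>R u = (\<Sum>i\<in>I. (s * \<beta> i) *\<^sub>R a i) + s *\<^sub>R m"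
          by (simp add: u scaleR_add_right scaleR_sum_right)
      qed (use * \<open>0 \<le> s\<close> in \<open>auto simp: mult_nonneg_nonpos\<close>)
    qed
  qed
  finally obtain \<beta> m where c: "- c = (\<Sum>i\<in>I. \<beta> i *\<^sub>R a i) + m" and \<beta>: "\<forall>i. 0 \<le> \<beta> i"
    and slack: "\<forall>i\<in>I. \<beta> i * (a i \<bullet> p - b i) = 0" and m: "\<forall>q\<in>D. m \<bullet> (q - p) \<le> 0"
    unfolding T_def by blast
  show thesis
  proof (rule that[of \<beta>])
    show "0 \<le> \<beta> i" for i
      using \<beta> by blast
    fix q
    assume "q \<in> D"
    \<comment> \<open>By complementary slackness \<open>b i\<close> may be replaced with
      \<open>a i \<bullet> p\<close>. The sum becomes \<open>(- c - m) \<bullet> (q - p)\<close>,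
      where the part with \<open>m\<close> has the right sign.\<close>
    have "(\<Sum>i\<in>I. \<beta> i * (a i \<bullet> q - b i)) =
        (\<Sum>i\<in>I. \<beta> i * (a i \<bullet> (q - p)) + \<beta> i * (a i \<bullet> p - b i))"
      by (simp add: algebra_simps)
    also have "\<dots> = (\<Sum>i\<in>I. \<beta> i * (a i \<bullet> (q - p)))"
      by (intro sum.cong) (simp_all add: slack)
    also have "\<dots> = (- c - m) \<bullet> (q - p)"
      unfolding c by (simp add: inner_sum_left)
    finally show "c \<bullet> p \<le> c \<bullet> q + (\<Sum>i\<in>I. \<beta> i * (a i \<bullet> q - b i))"
      using m[rule_format, OF \<open>q \<in> D\<close>] by (simp add: inner_diff_left inner_diff_right)
  qed
qed

section \<open>Passing from a quadratic objective to its linearisation\<close>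

text \<open>On the segment from \<open>p\<close> to \<open>q\<close> the increment of
  \<open>f\<close> is nonnegative; dividing it by \<open>t\<close> and letting \<open>t\<close> tend
  to 0 from the right removes the quadratic term.\<close>

lemma linearized_optimality:
  fixes p :: "'a::real_inner"
  assumes "convex K" and "p \<in> K" and min: "\<And>q. q \<in> K \<Longrightarrow> f p \<le> f q"
    and expansion: "\<And>q. f q = f p + g \<bullet> (q - p) + Q (q - p)"
    and homogeneous: "\<And>t v. Q (t *\<^sub>R v) = t\<^sup>2 * Q v"
    and "q \<in> K"
  shows "g \<bullet> p \<le> g \<bullet> q"
proof -
  have bound: "0 \<le> g \<bullet> (q - p) + t * Q (q - p)" if "0 < t" "t \<le> 1" for t :: real
  proof -
    have "p + t *\<^sub>R (q - p) \<in> K"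
      using convexD_alt[OF \<open>convex K\<close> \<open>p \<in> K\<close> \<open>q \<in> K\<close>, of t] that
      by (simp add: algebra_simps)
    then have "0 \<le> g \<bullet> (t *\<^sub>R (q - p)) + Q (t *\<^sub>R (q - p))"
      using min[of "p + t *\<^sub>R (q - p)"] expansion[of "p + t *\<^sub>R (q - p)"] by simp
    also have "\<dots> = t * (g \<bullet> (q - p) + t * Q (q - p))"
      unfolding homogeneous inner_scaleR_right by (simp add: power2_eq_square distrib_left)
    finally show ?thesis
      using \<open>0 < t\<close> by (simp add: zero_le_mult_iff)
  qed
  have "((\<lambda>t. g \<bullet> (q - p) + t * Q (q - p)) \<longlongrightarrow> g \<bullet> (q - p) + 0 * Q (q - p)) (at_right 0)"
    by (intro tendsto_intros)
  moreover have "\<forall>\<^sub>F t in at_right 0. 0 \<le> g \<bullet> (q - p) + t * Q (q - p)"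
    using eventually_at_right_less[of "0::real"] eventually_at_right_field[of _ "0::real"]
    by (metis (no_types, lifting) bound less_eq_real_def zero_less_one)
  ultimately have "0 \<le> g \<bullet> (q - p) + 0 * Q (q - p)"
    by (rule tendsto_lowerbound) simp
  then show ?thesis
    by (simp add: inner_diff_right)
qed

section \<open>The shifted problem as a quadratic program over a polyhedron\<close>

lemma polyhedron_shifted_domain:
  assumes "W = UNIV \<or> W = {0}"
  shows "polyhedron (shifted_domain k0 W :: ('d::finite, 'n::finite) svm_point set)"
proof -
  \<comment> \<open>The coordinate functionals reading off \<open>\<xi> $ i\<close> and
    \<open>z $ i\<close>, so that each bound becomes a half-space.\<close>
  define e :: "'n \<Rightarrow> ('d, 'n) svm_point" where "e i = (0, 0, axis i 1, 0)" for i
  define h :: "'n \<Rightarrow> ('d, 'n) svm_point" where "h i = (0, 0, 0, axis i 1)" for i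
  define K :: "'n \<Rightarrow> ('d, 'n) svm_point set" where
    "K i = {p. (e i + 2 *\<^sub>R h i) \<bullet> p \<le> 2} \<inter> {p. e i \<bullet> p \<ge> 0} \<inter> {p. e i \<bullet> p \<le> 2} \<inter>
      {p. h i \<bullet> p \<ge> 0} \<inter> {p. h i \<bullet> p \<le> 1}" for i
  have *: "e i \<bullet> (w, b, \<xi>, z) = \<xi> $ i" "h i \<bullet> (w, b, \<xi>, z) = z $ i" for i w b \<xi> z
    by (simp_all add: e_def h_def inner_Pair inner_axis')
  have "{p :: ('d, 'n) svm_point. (axis k0 1, 0, 0, 0) \<bullet> p \<in> W} = UNIV \<or>
      {p :: ('d, 'n) svm_point. (axis k0 1, 0, 0, 0) \<bullet> p \<in> W} = {p. (axis k0 1, 0, 0, 0) \<bullet> p = 0}"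
    using assms by auto
  then have "polyhedron {p :: ('d, 'n) svm_point. (axis k0 1, 0, 0, 0) \<bullet> p \<in> W}"
    by (metis polyhedron_UNIV polyhedron_hyperplane)
  moreover have "polyhedron (K i)" for i
    unfolding K_def
    by (intro polyhedron_Int polyhedron_halfspace_le polyhedron_halfspace_ge)
  then have "polyhedron (\<Inter>(range K))"
    by (intro polyhedron_Inter) auto
  moreover have "shifted_domain k0 W = {p. (axis k0 1, 0, 0, 0) \<bullet> p \<in> W} \<inter> \<Inter>(range K)"
    by (auto simp: shifted_domain_def K_def inner_add_left * inner_Pair inner_axis' algebra_simps)
  ultimately show ?thesis
    by simp
qed

text \<open>The gradient of the affine function \<open>shifted_gap\<close>. The shift
  \<open>wt\<close> enters only the constant term, so the normal is independent of \<open>k0\<close>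
  and \<open>wt\<close>.\<close>

definition gap_normal ::
  "real^'d^'n \<Rightarrow> real^'n \<Rightarrow> real^'n \<Rightarrow> 'n \<Rightarrow> ('d::finite, 'n::finite) svm_point" where
  "gap_normal x y M i = - (y $ i *\<^sub>R x $ i, y $ i, axis i 1, M $ i *\<^sub>R axis i 1)"

lemma shifted_gap_affine:
  "shifted_gap x y M k0 wt p i = gap_normal x y M i \<bullet> p - (y $ i * wt * x $ i $ k0 - 1)"
proof -
  have "(\<Sum>k\<in>UNIV. w $ k * x $ i $ k) = x $ i \<bullet> w" for w
    by (simp add: inner_vec_def mult.commute)
  then show ?thesis
    by (cases p) (simp add: gap_normal_def inner_Pair inner_axis' algebra_simps)
qed

lemma convex_shifted_feasible:
  assumes "W = UNIV \<or> W = {0}"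
  shows "convex (shifted_feasible x y M k0 wt W)"
proof -
  have "shifted_feasible x y M k0 wt W =
      shifted_domain k0 W \<inter> (\<Inter>i. {p. gap_normal x y M i \<bullet> p \<le> y $ i * wt * x $ i $ k0 - 1})"
    by (auto simp: shifted_feasible_def shifted_gap_affine)
  then show ?thesis
    using polyhedron_imp_convex[OF polyhedron_shifted_domain[OF assms]]
    by (auto intro!: convex_Int convex_INT convex_halfspace_le)
qed

text \<open>The exact Taylor expansion at \<open>p\<close>. Its remainder is homogeneous of degree
  two, which justifies linearising, and nonnegative, which allows the return to the quadratic
  objective.\<close>

lemma shifted_objective_expansion:
  fixes p q :: "('d::finite, 'n::finite) svm_point"
  shows "shifted_objective C k0 wt q = shifted_objective C k0 wt p +
    (fst p + axis k0 wt, 0, \<chi> i. C, \<chi> i. 2 * C) \<bullet> (q - p) + (norm (fst (q - p)))\<^sup>2 / 2"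
proof -
  obtain w b \<xi> z w' b' \<xi>' z' where p: "p = (w, b, \<xi>, z)" and q: "q = (w', b', \<xi>', z')"
    by (cases p, cases q) auto
  have sq: "(\<Sum>k\<in>UNIV. (v $ k)\<^sup>2) = v \<bullet> v" for v :: "real^'d"
    by (simp add: inner_vec_def power2_eq_square)
  have const: "(\<chi> i. c) \<bullet> v = c * (\<Sum>i\<in>UNIV. v $ i)" for c and v :: "real^'n"
    by (simp add: inner_vec_def sum_distrib_left)
  have "axis k0 wt \<bullet> v = wt * v $ k0" for v :: "real^'d"
    by (simp add: inner_axis')
  then show ?thesis
    by (simp add: p q sq const power2_norm_eq_inner inner_Pair inner_add_left inner_diff_left
        inner_diff_right inner_commute[of w' w] sum_subtractf field_simps)
qed

section \<open>Strong duality for the constraints (A)\<close>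

text \<open>The bound is stated pointwise on the domain because it is later evaluated at a point
  that may violate (A).\<close>

lemma shifted_strong_duality:
  fixes p :: "('d::finite, 'n::finite) svm_point"
  assumes W: "W = UNIV \<or> W = {0}"
    and opt: "is_arg_min (shifted_objective C k0 wt) (\<lambda>p. p \<in> shifted_feasible x y M k0 wt W) p"
    and \<alpha>: "shifted_dual_optimal C x y M k0 wt W \<alpha>"
    and q: "q \<in> shifted_domain k0 W"
  shows "shifted_objective C k0 wt p \<le> shifted_lagrangian C x y M k0 wt \<alpha> q"
proof -
  define g :: "('d, 'n) svm_point" where "g = (fst p + axis k0 wt, 0, \<chi> i. C, \<chi> i. 2 * C)"
  note expansion = shifted_objective_expansion[of C k0 wt _ p, folded g_def]
  have p: "p \<in> shifted_feasible x y M k0 wt W"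
    and min: "\<And>q. q \<in> shifted_feasible x y M k0 wt W \<Longrightarrow>
      shifted_objective C k0 wt p \<le> shifted_objective C k0 wt q"
    using opt by (auto simp: is_arg_min_linorder)
  have lin: "g \<bullet> p \<le> g \<bullet> q" if "q \<in> shifted_feasible x y M k0 wt W" for q
  proof (rule linearized_optimality[OF convex_shifted_feasible[OF W] p min expansion _ that])
    show "(norm (fst (t *\<^sub>R v)))\<^sup>2 / 2 = t\<^sup>2 * ((norm (fst v))\<^sup>2 / 2)"
      for t and v :: "('d, 'n) svm_point"
      by (simp add: power_mult_distrib)
  qed
  obtain \<beta> where \<beta>: "\<And>i. 0 \<le> \<beta> i" and mult: "\<And>q. q \<in> shifted_domain k0 W \<Longrightarrow>
      g \<bullet> p \<le> g \<bullet> q + (\<Sum>i\<in>UNIV. \<beta> i * (gap_normal x y M i \<bullet> q - (y $ i * wt * x $ i $ k0 - 1)))"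
  proof (rule linear_program_multipliers)
    show "finite (UNIV :: 'n set)"
      by simp
    show "polyhedron (shifted_domain k0 W :: ('d, 'n) svm_point set)"
      by (rule polyhedron_shifted_domain[OF W])
    show "p \<in> shifted_domain k0 W"
      "\<And>i. gap_normal x y M i \<bullet> p \<le> y $ i * wt * x $ i $ k0 - 1"
      using p by (auto simp: shifted_feasible_def shifted_gap_affine)
    show "g \<bullet> p \<le> g \<bullet> q" if "q \<in> shifted_domain k0 W"
      "\<And>i. i \<in> UNIV \<Longrightarrow> gap_normal x y M i \<bullet> q \<le> y $ i * wt * x $ i $ k0 - 1" for q
      using that by (intro lin) (auto simp: shifted_feasible_def shifted_gap_affine)
  qed blast
  \<comment> \<open>The objective at \<open>q\<close> exceeds its linearisation at \<open>p\<close>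
    by half a square, so the linear bound carries over to the Lagrangian.\<close>
  have "shifted_objective C k0 wt p \<le> shifted_lagrangian C x y M k0 wt (\<chi> i. \<beta> i) q"
    if "q \<in> shifted_domain k0 W" for q
    unfolding shifted_lagrangian_def shifted_gap_affine vec_lambda_beta
    using mult[OF that] expansion[of q, unfolded inner_diff_right]
      zero_le_power2[of "norm (fst (q - p))"] by linarith
  then have "ereal (shifted_objective C k0 wt p)
      \<le> shifted_dual_function C x y M k0 wt W (\<chi> i. \<beta> i)"
    unfolding shifted_dual_function_def by (intro INF_greatest) simp
  \<comment> \<open>The multipliers \<beta> are nonnegative, hence compete with the dual optimum
    \<alpha>.\<close>
  also have "\<dots> \<le> shifted_dual_function C x y M k0 wt W \<alpha>"
    using \<alpha> \<beta> by (auto simp: shifted_dual_optimal_def is_arg_max_linorder)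
  also have "\<dots> \<le> ereal (shifted_lagrangian C x y M k0 wt \<alpha> q)"
    unfolding shifted_dual_function_def using q by (rule INF_lower)
  finally show ?thesis
    by simp
qed

section \<open>Comparing the Lagrangian with the unshifted objective\<close>

text \<open>
  The point with its \<open>k0\<close>-th weight replaced by \<open>0\<close> lies in the domain for \<open>W = UNIV\<close> as well as
  for \<open>W = {0}\<close>, so both readings of the shifted problem are treated at once.
\<close>

lemma lagrangian_zeroed_weight_le:
  fixes w :: "real^'d::finite" and \<alpha> :: "real^'n::finite"
  assumes feasible: "(w, b, \<xi>, z) \<in> re_rl_feasible x y M" and \<alpha>: "\<And>i. 0 \<le> \<alpha> $ i"
  shows "shifted_lagrangian C x y M k0 wt \<alpha> (w - axis k0 (w $ k0), b, \<xi>, z)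
    \<le> rl_objective C (w, b, \<xi>, z) - ((w $ k0)\<^sup>2 - wt\<^sup>2) / 2
      + (w $ k0 - wt) * (\<Sum>i\<in>UNIV. \<alpha> $ i * y $ i * x $ i $ k0)"
proof -
  let ?w = "w - axis k0 (w $ k0)"
  have sq: "(\<Sum>k\<in>UNIV. (v $ k)\<^sup>2) = v \<bullet> v" for v :: "real^'d"
    by (simp add: inner_vec_def power2_eq_square)
  have "?w \<bullet> ?w = w \<bullet> w - (w $ k0)\<^sup>2"
    by (simp add: inner_diff_left inner_diff_right inner_axis inner_axis' power2_eq_square)
  \<comment> \<open>The cross term of the shifted objective vanishes, since the \<open>k0\<close>-th
    weight is now 0.\<close>
  then have objective: "shifted_objective C k0 wt (?w, b, \<xi>, z) =
      rl_objective C (w, b, \<xi>, z) - ((w $ k0)\<^sup>2 - wt\<^sup>2) / 2"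
    unfolding shifted_objective.simps rl_objective.simps sq by (simp add: field_simps)
  \<comment> \<open>In (A) the shift \<open>wt\<close> stands in for the removed weight, so the
    original constraint changes only by the difference of the two times
    \<open>y $ i * x $ i $ k0\<close>.\<close>
  have gap: "shifted_gap x y M k0 wt (?w, b, \<xi>, z) i \<le> (w $ k0 - wt) * (y $ i * x $ i $ k0)" for i
  proof -
    have *: "(\<Sum>k\<in>UNIV. v $ k * x $ i $ k) = v \<bullet> x $ i" for v i
      by (simp add: inner_vec_def)
    have "y $ i * (w \<bullet> x $ i + b) \<ge> 1 - \<xi> $ i - M $ i * z $ i"
      using feasible by (simp add: re_rl_feasible_def *)
    then show ?thesis
      unfolding shifted_gap.simps * inner_diff_left inner_axis' by (simp add: algebra_simps)
  qed
  have "(\<Sum>i\<in>UNIV. \<alpha> $ i * shifted_gap x y M k0 wt (?w, b, \<xi>, z) i)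
      \<le> (\<Sum>i\<in>UNIV. \<alpha> $ i * ((w $ k0 - wt) * (y $ i * x $ i $ k0)))"
    by (intro sum_mono mult_left_mono gap \<alpha>)
  also have "\<dots> = (w $ k0 - wt) * (\<Sum>i\<in>UNIV. \<alpha> $ i * y $ i * x $ i $ k0)"
    by (simp add: sum_distrib_left algebra_simps)
  finally show ?thesis
    unfolding shifted_lagrangian_def objective by simp
qed

section \<open>Upper bounds of the mixed-integer problem\<close>

lemma rl_feasible_subset_re_rl_feasible: "rl_feasible x y M \<subseteq> re_rl_feasible x y M"
proof -
  have "0 \<le> t \<and> t \<le> 1" if "t \<in> {0, 1}" for t :: real
    using that by auto
  then show ?thesis
    unfolding rl_feasible_def re_rl_feasible_def by blast
qed

text \<open>The infimum might not be attained, so feasible points are only obtained up to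
  \<epsilon>. The empty infimum is \<infinity>, so a real upper bound already forces
  feasibility.\<close>

lemma rl_upper_bound_approx:
  fixes x :: "real^'d::finite^'n::finite"
  assumes "rl_upper_bound C x y M u" and "0 < \<epsilon>"
  obtains p where "p \<in> rl_feasible x y M" and "rl_objective C p < u + \<epsilon>"
proof -
  have "(INF p \<in> rl_feasible x y M. ereal (rl_objective C p)) < ereal (u + \<epsilon>)"
    using assms unfolding rl_upper_bound_def by (auto elim: le_less_trans)
  then show thesis
    using that by (auto simp: INF_less_iff)
qed

section \<open>The bounds on the weight\<close>

theorem corollary4p2:
  fixes x :: "real^'d::finite^'n::finite" and y M \<alpha> \<xi>' z' :: "real^'n" and w' :: "real^'d"
    and C wt Z UB b' S \<Delta> :: real and k0 :: 'd and W :: "real set"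
  assumes "C \<ge> 0"
    and "\<And>i. y $ i \<in> {-1, 1}"
    and "W = UNIV \<or> W = {0}"
    and "is_arg_min (shifted_objective C k0 wt) (\<lambda>p. p \<in> shifted_feasible x y M k0 wt W) (w', b', \<xi>', z')"
    and "w' $ k0 = 0"
    and "Z = shifted_objective C k0 wt (w', b', \<xi>', z')"
    and "shifted_dual_optimal C x y M k0 wt W \<alpha>"
    and "rl_upper_bound C x y M UB"
    and "S = (\<Sum>i\<in>UNIV. \<alpha> $ i * y $ i * x $ i $ k0)"
    and "\<Delta> = (wt - S)\<^sup>2 - 2 * (Z - UB)"
  shows "\<Delta> \<ge> 0 \<and>
    (\<forall>w b \<xi> z. (w, b, \<xi>, z) \<in> re_rl_feasible x y M \<and> rl_objective C (w, b, \<xi>, z) \<le> UB \<longrightarrow>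
       S - sqrt \<Delta> \<le> w $ k0 \<and> w $ k0 \<le> S + sqrt \<Delta>) \<and>
    (\<forall>w b \<xi> z. is_arg_min (rl_objective C) (\<lambda>p. p \<in> re_rl_feasible x y M) (w, b, \<xi>, z) \<longrightarrow>
       S - sqrt \<Delta> \<le> w $ k0 \<and> w $ k0 \<le> S + sqrt \<Delta>)"
proof -
  have \<alpha>: "\<And>i. 0 \<le> \<alpha> $ i"
    using assms(7) by (auto simp: shifted_dual_optimal_def is_arg_max_def)
  \<comment> \<open>The excess over \<open>UB\<close> is kept as a term, so that the estimate also
    applies to points only nearly as good as \<open>UB\<close>.\<close>
  have bound: "(w $ k0 - S)\<^sup>2 \<le> \<Delta> + 2 * (rl_objective C (w, b, \<xi>, z) - UB)"
    if "(w, b, \<xi>, z) \<in> re_rl_feasible x y M" for w b \<xi> z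
  proof -
    have "(w - axis k0 (w $ k0), b, \<xi>, z) \<in> shifted_domain k0 W"
      using that assms(3) by (auto simp: re_rl_feasible_def shifted_domain_def)
    then have "Z \<le> shifted_lagrangian C x y M k0 wt \<alpha> (w - axis k0 (w $ k0), b, \<xi>, z)"
      using shifted_strong_duality[OF assms(3,4,7)] assms(6) by simp
    also note lagrangian_zeroed_weight_le[OF that \<alpha>]
    finally have "2 * Z \<le> 2 * rl_objective C (w, b, \<xi>, z) - ((w $ k0)\<^sup>2 - wt\<^sup>2) + 2 * ((w $ k0 - wt) * S)"
      unfolding assms(9) by argo
    then show ?thesis
      unfolding assms(10) power2_eq_square by (simp add: algebra_simps del: rl_objective.simps)
  qed
  \<comment> \<open>Near-optimal mixed-integer points make the right side of \<open>bound\<close> at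
    most \<open>\<Delta> + e\<close>; the tolerance \<open>e / 2\<close> offsets the factor 2
    there.\<close>
  have "\<Delta> \<ge> 0"
  proof (rule field_le_epsilon)
    fix e :: real
    assume "0 < e"
    then obtain p where p: "p \<in> rl_feasible x y M" "rl_objective C p < UB + e / 2"
      using rl_upper_bound_approx[OF assms(8), of "e / 2"] half_gt_zero by blast
    obtain w b \<xi> z where p_eq: "p = (w, b, \<xi>, z)"
      by (cases p) auto
    have "0 \<le> (w $ k0 - S)\<^sup>2"
      by simp
    also have "\<dots> \<le> \<Delta> + 2 * (rl_objective C p - UB)"
      using bound p(1) rl_feasible_subset_re_rl_feasible unfolding p_eq by blast
    finally show "0 \<le> \<Delta> + e"
      using p(2) by argo
  qed
  moreover have interval: "S - sqrt \<Delta> \<le> w $ k0 \<and> w $ k0 \<le> S + sqrt \<Delta>"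
    if "(w, b, \<xi>, z) \<in> re_rl_feasible x y M" "rl_objective C (w, b, \<xi>, z) \<le> UB" for w b \<xi> z
  proof -
    have "(w $ k0 - S)\<^sup>2 \<le> \<Delta>"
      using bound[OF that(1)] that(2) by argo
    then have "\<bar>w $ k0 - S\<bar> \<le> sqrt \<Delta>"
      by (metis real_sqrt_abs real_sqrt_le_mono)
    then show ?thesis
      by linarith
  qed
  moreover have "S - sqrt \<Delta> \<le> w $ k0 \<and> w $ k0 \<le> S + sqrt \<Delta>"
    if opt: "is_arg_min (rl_objective C) (\<lambda>p. p \<in> re_rl_feasible x y M) (w, b, \<xi>, z)" for w b \<xi> z
  proof (rule interval)
    show "(w, b, \<xi>, z) \<in> re_rl_feasible x y M"
      using opt by (simp add: is_arg_min_linorder)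
    show "rl_objective C (w, b, \<xi>, z) \<le> UB"
    \<comment> \<open>A minimiser of the relaxation is at least as good as every mixed-integer
      point, and these come arbitrarily close to \<open>UB\<close> or below it.\<close>
    proof (rule field_le_epsilon)
      fix e :: real
      assume "0 < e"
      then obtain p where p: "p \<in> rl_feasible x y M" "rl_objective C p < UB + e"
        using rl_upper_bound_approx[OF assms(8)] by blast
      then have "rl_objective C (w, b, \<xi>, z) \<le> rl_objective C p"
        using opt rl_feasible_subset_re_rl_feasible unfolding is_arg_min_linorder by blast
      with p(2) show "rl_objective C (w, b, \<xi>, z) \<le> UB + e"
        by linarith
    qed
  qed
  ultimately show ?thesis
    by blast
qed

end
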